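(* Let $I$ and $S$ be real intervals of positive length and suppose that the one-parameter family of functions $\xi_{s}\colon I\to \mathbb{R}$ $(s\in S)$ can be represented as $$\xi_{s}(x)= x^{r}F(x\cdot H^{-1}(s))\qquad (x\in I,\ s\in S)$$ and also as $$\xi_{s}(x)= u^{-1}(s+w(x))\qquad (x\in I,\ s\in S)$$ with an appropriate nonzero real constant $r$, continuous and strictly increasing functions $u$, $w$ and $H$, and with a continuous function $F$. If the domains of the functions $u, w$ and $H$ and the range of the function $F$ are contained in the set of positive reals, then one of the following cases holds. Case I: $$\xi_{s}(x)= a\, e^{b\rho s}\, x^{r+\rho}\qquad (x\in I,\ s\in S)$$ with appropriate constants $a$, $b$ and $\rho$. Case II: $$\xi_{s}(x)= a\left(c\,x^{\frac{r}{\rho}}+s-\varepsilon\right)^{\rho}\qquad (x\in I,\ s\in S)$$ with appropriate constants $a$, $\varepsilon$, $\rho$ and $c$.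
   Context: The domains of $u,w,H,F$ are such that the displayed expressions make sense for all $x\in I$, $s\in S$. The constants are real.
   Formalization: In Case II the base may be negative throughout (e.g. ξ_s(x)=(x^(-2)−s)^(-1/2)), where its real power is undefined; the formula is proved as a(σ(c x^(r/ρ)+s−ε))^ρ with one global sign σ=±1 making the base positive, and ρ≠0. *)

theory Defs
  imports "HOL-Analysis.Analysis"
begin

definition interval_of_positive_length :: "real set \<Rightarrow> bool" where
  "interval_of_positive_length J \<longleftrightarrow> is_interval J \<and> (\<exists>p\<in>J. \<exists>q\<in>J. p < q)"

definition case_I :: "real set \<Rightarrow> real set \<Rightarrow> real \<Rightarrow> (real \<Rightarrow> real \<Rightarrow> real) \<Rightarrow> bool" where
  "case_I I S r \<xi> \<longleftrightarrow>
    (\<exists>a b \<rho>. \<forall>x\<in>I. \<forall>s\<in>S. \<xi> s x = a * exp (b * \<rho> * s) * x powr (r + \<rho>))"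

(* The family a (c x^(r/rho) + s - eps)^rho.

   The base of the outer power may be negative throughout I x S, where a real power is not
   defined for a general exponent rho.  An example is xi_s(x) = (x^(-2) - s)^(-1/2), with
   r = 1, u(y) = - y^(-2), w(x) = - x^(-2), H(y) = y^2, F(z) = (1 - z^2)^(-1/2): it has
   rho = -1/2, c = -1, eps = 0 and base s - x^(-2) < 0, and no other constants represent it.
   The sign sg, one of 1 and -1 for the whole family, makes the base positive; for sg = 1
   the formula is the displayed one, and where z^rho is real for z < 0 the factor sg^rho
   only changes the sign of a.  It also avoids relying on powr at negative
   arguments, where it is the power of the absolute value. *)
definition case_II :: "real set \<Rightarrow> real set \<Rightarrow> real \<Rightarrow> (real \<Rightarrow> real \<Rightarrow> real) \<Rightarrow> bool" where
  "case_II I S r \<xi> \<longleftrightarrow>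
    (\<exists>a c \<epsilon> \<rho>. \<rho> \<noteq> 0 \<and>
      (\<exists>sg\<in>{1, - 1}. \<forall>x\<in>I. \<forall>s\<in>S.
         sg * (c * x powr (r / \<rho>) + s - \<epsilon>) > 0 \<and>
         \<xi> s x = a * (sg * (c * x powr (r / \<rho>) + s - \<epsilon>)) powr \<rho>))"

end

theory Submission
  imports Defs
begin

text \<open>
  In the logarithmic coordinate \<open>y = ln x\<close>, with \<open>v y = w (exp y)\<close>, \<open>k s = ln (H\<inverse> s)\<close>,
  \<open>\<phi> = ln \<circ> u\<inverse>\<close> and \<open>f z = ln (F (exp z))\<close>, equality of the two representations becomes
  \<open>\<phi> (s + v y) = r y + f (y + k s)\<close>. The proof uses only this equation, monotonicity and
  continuity; nothing has to be differentiable.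

  Moving \<open>y\<close> to \<open>y + c\<close> and \<open>s\<close> to the parameter \<open>s'\<close> with \<open>k s' = k s - c\<close> fixes the argument
  of \<open>f\<close>, so \<open>\<phi> (s' + v (y + c)) = \<phi> (s + v y) + r c\<close> (\<open>phi_shift\<close>). For fixed \<open>c\<close>, the number
  \<open>s' + v (y + c)\<close> therefore depends on \<open>s + v y\<close> only. This is a Pexider equation, and it forces
  \<open>v (y + c)\<close> to be an affine function of \<open>v y\<close> (\<open>v_shift_affine\<close>). Its slope is multiplicative in
  \<open>c\<close>, hence \<open>exp (\<mu> c)\<close> for some \<open>\<mu>\<close>, and a function with this property is affine in \<open>y\<close> if
  \<open>\<mu> = 0\<close> and affine in \<open>exp (\<mu> y)\<close> otherwise (\<open>exp_or_id_if_increments_scale\<close>).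

  Read for a fixed \<open>s\<close>, the same identity says that translating the argument of the inverse of \<open>\<phi>\<close>
  by \<open>r c\<close> multiplies its increments by \<open>exp (\<mu> c)\<close>. So the inverse of \<open>\<phi>\<close> has the same
  form with \<open>\<mu> / r\<close> in place of \<open>\<mu>\<close>, locally (\<open>phi_locally_affine\<close>) and then, by connectedness,
  everywhere (\<open>representation\<close>). If \<open>\<mu> = 0\<close>, then \<open>ln \<xi>\<close> is affine in \<open>s\<close> and \<open>ln x\<close>, which is
  Case I; otherwise \<open>\<xi>\<close> to the power \<open>\<mu> / r\<close> is affine in \<open>s\<close> and \<open>x\<close> to the power \<open>\<mu>\<close>, which is
  Case II.

  The domains of \<open>H\<close> and \<open>u\<close> may have gaps, so \<open>H\<inverse>\<close> and \<open>u\<inverse>\<close> may jump, and the parameter \<open>s'\<close>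
  need not exist. Jumps of \<open>k\<close> that are large in comparison with the length of the range of
  \<open>y\<close> may occur, but they stay away from some short interval near any given parameter. A smaller
  jump is impossible, because it would contradict the strict monotonicity of \<open>f\<close> that
  the equation enforces (\<open>k_fills_interval\<close>). So there are good parameters arbitrarily close to every
  \<open>s\<close>, and perturbing \<open>s\<close> while keeping \<open>s + v y\<close> is enough to reach every argument of \<open>\<phi>\<close>.
\<close>

section \<open>Monotone and locally affine functions on real intervals\<close>

lemma locally_constant_imp_constant:
  fixes g :: "real \<Rightarrow> real"
  assumes "is_interval B"
    and "\<And>x. x \<in> B \<Longrightarrow> \<exists>e>0. \<forall>y\<in>B. \<bar>y - x\<bar> < e \<longrightarrow> g y = g x"
  shows "\<exists>C. \<forall>x\<in>B. g x = C"
proof (rule has_field_derivative_zero_constant)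
  show "convex B"
    using assms(1) by (simp add: is_interval_convex)
  fix x assume x: "x \<in> B"
  then obtain e where e: "e > 0" "\<forall>y\<in>B. \<bar>y - x\<bar> < e \<longrightarrow> g y = g x"
    using assms(2) by blast
  have "((\<lambda>_. g x) has_field_derivative 0) (at x within B)"
    by simp
  then show "(g has_field_derivative 0) (at x within B)"
    by (rule has_field_derivative_transform_within[OF _ e(1) x]) (use e in \<open>auto simp: dist_real_def\<close>)
qed

text \<open>
  The derivative of \<open>g\<close> is locally constant, hence constant, so subtracting a linear function
  leaves derivative zero.
\<close>

lemma locally_affine_imp_affine:
  fixes g :: "real \<Rightarrow> real"
  assumes T: "is_interval T" "open T"
    and loc: "\<And>t. t \<in> T \<Longrightarrow> \<exists>U m n. open U \<and> t \<in> U \<and> (\<forall>x\<in>U. g x = m * x + n)"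
  shows "\<exists>m n. \<forall>t\<in>T. g t = m * t + n"
proof -
  have slope: "\<exists>U m. open U \<and> t \<in> U \<and> (\<forall>x\<in>U. (g has_field_derivative m) (at x))"
    if "t \<in> T" for t
  proof -
    from loc[OF that] obtain U m n
      where U: "open U" "t \<in> U" "\<forall>x\<in>U. g x = m * x + n"
      by blast
    have "(g has_field_derivative m) (at x)" if "x \<in> U" for x
    proof -
      have "((\<lambda>x. m * x + n) has_field_derivative m) (at x)"
        by (auto intro!: derivative_eq_intros)
      then show ?thesis
        by (rule has_field_derivative_transform_within_open[OF _ U(1) that]) (use U in auto)
    qed
    with U show ?thesis
      by blast
  qed
  have "\<exists>m. \<forall>t\<in>T. deriv g t = m"
  proof (rule locally_constant_imp_constant[OF T(1)])
    fix t assume "t \<in> T"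
    from slope[OF this] obtain U m
      where U: "open U" "t \<in> U" "\<forall>x\<in>U. (g has_field_derivative m) (at x)"
      by blast
    obtain e where e: "e > 0" "ball t e \<subseteq> U"
      using U openE by blast
    have "\<forall>y\<in>T. \<bar>y - t\<bar> < e \<longrightarrow> deriv g y = deriv g t"
    proof (intro ballI impI)
      fix y assume "\<bar>y - t\<bar> < e"
      then have "y \<in> U"
        using e by (auto simp: dist_real_def)
      then show "deriv g y = deriv g t"
        using U by (metis DERIV_imp_deriv)
    qed
    with e show "\<exists>e>0. \<forall>y\<in>T. \<bar>y - t\<bar> < e \<longrightarrow> deriv g y = deriv g t"
      by blast
  qed
  then obtain m where m: "\<And>t. t \<in> T \<Longrightarrow> deriv g t = m"
    by blast
  have "\<exists>n. \<forall>t\<in>T. g t - m * t = n"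
  proof (rule has_field_derivative_zero_constant)
    show "convex T"
      using T by (simp add: is_interval_convex)
    fix t assume t: "t \<in> T"
    from slope[OF t] have "(g has_field_derivative m) (at t)"
      by (metis DERIV_imp_deriv m t)
    then have "((\<lambda>t. g t - m * t) has_field_derivative 0) (at t)"
      by (auto intro!: derivative_eq_intros)
    then show "((\<lambda>t. g t - m * t) has_field_derivative 0) (at t within T)"
      by (rule has_field_derivative_at_within)
  qed
  then obtain n where "\<And>t. t \<in> T \<Longrightarrow> g t - m * t = n"
    by blast
  then have "\<forall>t\<in>T. g t = m * t + n"
    by (force simp: algebra_simps)
  then show ?thesis
    by blast
qed

text \<open>
  After subtracting a chord, \<open>G\<close> takes equal values at the ends of \<open>[a, b]\<close> and so has an
  extremum \<open>x0\<close> inside. By hypothesis the increment over a small step \<open>h\<close> is the same to the left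
  and to the right of \<open>x0\<close>, while at an extremum these two increments have opposite signs. Hence the
  increment is zero, at \<open>x0\<close> and, again by hypothesis, everywhere.
\<close>

lemma affine_if_increments_translation_invariant:
  fixes g :: "real \<Rightarrow> real"
  assumes B: "is_interval B" and g: "continuous_on B g" and h0: "h0 > 0"
    and inv: "\<And>h x y. \<lbrakk>0 < h; h < h0; x \<in> B; x + h \<in> B; y \<in> B; y + h \<in> B\<rbrakk>
                \<Longrightarrow> g (x + h) - g x = g (y + h) - g y"
  shows "\<exists>m n. \<forall>x\<in>B. g x = m * x + n"
proof (cases "\<exists>a\<in>B. \<exists>b\<in>B. a < b")
  case False
  then have eq: "x = y" if "x \<in> B" "y \<in> B" for x y
    using that by (metis linorder_neqE_linordered_idom)
  have "g x = 0 * x + g (SOME y. y \<in> B)" if "x \<in> B" for x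
    using eq[OF that someI[of "\<lambda>y. y \<in> B"], OF that] by simp
  then show ?thesis
    by blast
next
  case True
  then obtain a b where ab: "a \<in> B" "b \<in> B" "a < b"
    by blast
  \<comment> \<open>the slope of the chord over \<open>[a, b]\<close>\<close>
  define m where "m = (g b - g a) / (b - a)"
  define G where "G = (\<lambda>x. g x - m * x)"
  have sub: "{a..b} \<subseteq> B"
    using mem_is_interval_1_I[OF B ab(1,2)] by auto
  have ends: "G a = G b"
  proof -
    have "m * (b - a) = g b - g a"
      using ab by (simp add: m_def)
    then show ?thesis
      by (simp add: G_def algebra_simps)
  qed
  have Gc: "continuous_on {a..b} G"
    unfolding G_def using g sub by (intro continuous_intros) (auto intro: continuous_on_subset)
  have G_inv: "G (x + h) - G x = G (y + h) - G y"
    if "0 < h" "h < h0" "x \<in> B" "x + h \<in> B" "y \<in> B" "y + h \<in> B" for h x y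
    using inv[OF that] by (simp add: G_def algebra_simps)
  obtain M where M: "M \<in> {a..b}" "\<And>y. y \<in> {a..b} \<Longrightarrow> G y \<le> G M"
    using continuous_attains_sup[OF compact_Icc _ Gc] ab by auto
  obtain N where N: "N \<in> {a..b}" "\<And>y. y \<in> {a..b} \<Longrightarrow> G N \<le> G y"
    using continuous_attains_inf[OF compact_Icc _ Gc] ab by auto
  obtain x0 where x0: "a < x0" "x0 < b"
    and ext: "(\<forall>y\<in>{a..b}. G y \<le> G x0) \<or> (\<forall>y\<in>{a..b}. G x0 \<le> G y)"
  proof (cases "M \<in> {a<..<b} \<or> N \<in> {a<..<b}")
    case True
    then show ?thesis
      using that M(2) N(2) by auto
  next
    case False
    then have "G M = G a" "G N = G a"
      using M(1) N(1) ends by (auto simp: less_le)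
    then have const: "G y = G M" if "y \<in> {a..b}" for y
      using M(2)[OF that] N(2)[OF that] by simp
    have mid: "a < (a + b) / 2" "(a + b) / 2 < b"
      using ab by auto
    then have "\<forall>y\<in>{a..b}. G y \<le> G ((a + b) / 2)"
      using M(2) const[of "(a + b) / 2"] by auto
    with mid show ?thesis
      using that by blast
  qed
  define \<eta> where "\<eta> = Min {h0, x0 - a, b - x0}"
  have \<eta>: "\<eta> > 0" "\<eta> \<le> h0" "\<eta> \<le> x0 - a" "\<eta> \<le> b - x0"
    using h0 x0 by (auto simp: \<eta>_def)
  have flat: "G (x + h) = G x" if h: "0 < h" "h < \<eta>" and x: "x \<in> B" "x + h \<in> B" for x h
  proof -
    have in_ab: "x0 \<in> {a..b}" "x0 + h \<in> {a..b}" "x0 - h \<in> {a..b}"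
      using h \<eta> x0 by auto
    have "G (x0 + h) - G x0 = G (x0 - h + h) - G (x0 - h)"
      by (rule G_inv) (use h \<eta> in_ab sub in auto)
    moreover have "G (x0 + h) \<le> G x0 \<and> G (x0 - h) \<le> G x0 \<or> G x0 \<le> G (x0 + h) \<and> G x0 \<le> G (x0 - h)"
      using ext in_ab by blast
    ultimately have "G (x0 + h) - G x0 = 0"
      by auto
    moreover have "G (x + h) - G x = G (x0 + h) - G x0"
      by (rule G_inv) (use h \<eta> in_ab sub x in auto)
    ultimately show ?thesis
      by simp
  qed
  have "\<exists>n. \<forall>x\<in>B. G x = n"
  proof (rule locally_constant_imp_constant[OF B])
    fix x assume x: "x \<in> B"
    have "G y = G x" if "y \<in> B" "\<bar>y - x\<bar> < \<eta>" for y
      using flat[of "y - x" x] flat[of "x - y" y] that x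
      by (cases y x rule: linorder_cases) auto
    then show "\<exists>e>0. \<forall>y\<in>B. \<bar>y - x\<bar> < e \<longrightarrow> G y = G x"
      using \<eta> by blast
  qed
  then obtain n where "\<And>x. x \<in> B \<Longrightarrow> G x = n"
    by blast
  then have "\<forall>x\<in>B. g x = m * x + n"
    by (force simp: G_def algebra_simps)
  then show ?thesis
    by blast
qed

text \<open>
  A maximum of \<open>f\<close> over \<open>[x, y]\<close> cannot be attained before \<open>y\<close>, since a sufficiently small increasing
  step would exceed it.
\<close>

lemma strict_mono_on_if_arbitrarily_small_steps_increase:
  fixes f :: "real \<Rightarrow> real"
  assumes f: "continuous_on {a..b} f"
    and step: "\<And>\<eta>. \<eta> > 0 \<Longrightarrow> \<exists>c. 0 < c \<and> c < \<eta> \<and> (\<forall>z. a \<le> z \<and> z + c \<le> b \<longrightarrow> f z < f (z + c))"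
  shows "strict_mono_on {a..b} f"
proof (rule strict_mono_onI)
  fix x y assume xy: "x \<in> {a..b}" "y \<in> {a..b}" "x < y"
  have fc: "continuous_on {x..y} f"
    by (rule continuous_on_subset[OF f]) (use xy in auto)
  obtain M where M: "M \<in> {x..y}" "\<And>z. z \<in> {x..y} \<Longrightarrow> f z \<le> f M"
    using continuous_attains_sup[OF compact_Icc _ fc] xy by auto
  have only_y: "\<exists>z\<in>{x..y}. f w < f z" if w: "w \<in> {x..<y}" for w
  proof -
    obtain c where "0 < c" "c < y - w" "\<forall>z. a \<le> z \<and> z + c \<le> b \<longrightarrow> f z < f (z + c)"
      using step[of "y - w"] w by (metis atLeastLessThan_iff diff_gt_0_iff_gt)
    then show ?thesis
      using w xy by (intro bexI[of _ "w + c"]) auto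
  qed
  then have "M = y"
    using M by (metis atLeastAtMost_iff atLeastLessThan_iff less_le not_le)
  then show "f x < f y"
    using only_y[of x] M xy by fastforce
qed

text \<open>
  By bisection: one of the two halves carries at most half of the increment. Applied to an
  increasing function that may jump, this finds an interval on which all jumps are small.
\<close>

lemma small_increment_on_subinterval:
  fixes k :: "real \<Rightarrow> real"
  assumes "p < q" and "\<delta> > 0"
  obtains p' q' where "p \<le> p'" "p' < q'" "q' \<le> q" "k q' - k p' < \<delta>"
proof -
  have "\<exists>p' q'. p \<le> p' \<and> p' < q' \<and> q' \<le> q \<and> k q' - k p' < \<delta>"
    if "p < q" "k q - k p < 2 ^ n * \<delta>" for n p q
    using that
  proof (induction n arbitrary: p q)
    case 0
    then show ?case by auto
  next
    case (Suc n)
    define m where "m = (p + q) / 2"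
    have pmq: "p < m" "m < q"
      using Suc.prems by (auto simp: m_def)
    have "(k q - k m) + (k m - k p) < 2 ^ n * \<delta> + 2 ^ n * \<delta>"
      using Suc.prems by (simp add: algebra_simps)
    then consider "k q - k m < 2 ^ n * \<delta>" | "k m - k p < 2 ^ n * \<delta>"
      by linarith
    then show ?case
    proof cases
      case 1
      show ?thesis
        using Suc.IH[OF pmq(2) 1] pmq by (meson less_le_trans order.strict_implies_order order_trans)
    next
      case 2
      show ?thesis
        using Suc.IH[OF pmq(1) 2] pmq by (meson less_le_trans order.strict_implies_order order_trans)
    qed
  qed
  moreover obtain n where "(k q - k p) / \<delta> < 2 ^ n"
    using real_arch_pow[of 2] by auto
  then have "k q - k p < 2 ^ n * \<delta>"
    using assms by (simp add: field_simps)
  ultimately show ?thesis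
    using assms that by blast
qed

text \<open>
  Jumps of \<open>f\<close> only remove points from the domain of the inverse; they do not affect its continuity.
\<close>

lemma continuous_on_inverse_strict_mono:
  fixes f :: "real \<Rightarrow> real"
  assumes A: "is_interval A" and f: "strict_mono_on A f"
  shows "continuous_on (f ` A) (inv_into A f)"
proof -
  have inv: "inv_into A f (f x) = x" if "x \<in> A" for x
    using f that by (simp add: strict_mono_on_imp_inj_on)
  have less: "f x < f y \<longleftrightarrow> x < y" if "x \<in> A" "y \<in> A" for x y
    using f that by (simp add: strict_mono_on_less)
  have ev: "\<forall>\<^sub>F s in at t within f ` A. s \<in> f ` A" for t
    by (simp add: eventually_at_filter)
  show ?thesis
    unfolding continuous_on_def
  proof (intro ballI order_tendstoI)
    fix t l assume "t \<in> f ` A" and l: "l < inv_into A f t"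
    then obtain x where x: "x \<in> A" "t = f x"
      by blast
    show "\<forall>\<^sub>F s in at t within f ` A. l < inv_into A f s"
    proof (cases "l \<in> A")
      case True
      then have "\<forall>\<^sub>F s in at t within f ` A. f l < s"
        using less l x inv by (intro order_tendstoD(1)[OF tendsto_ident_at]) auto
      with ev show ?thesis
        by eventually_elim (use less True inv in auto)
    next
      case False
      then have "l < y" if "y \<in> A" for y
        using mem_is_interval_1_I[OF A that x(1), of l] l x inv[OF x(1)] by force
      then show ?thesis
        by (intro eventually_mono[OF ev]) (auto simp: inv)
    qed
  next
    fix t l assume "t \<in> f ` A" and l: "inv_into A f t < l"
    then obtain x where x: "x \<in> A" "t = f x"
      by blast
    show "\<forall>\<^sub>F s in at t within f ` A. inv_into A f s < l"
    proof (cases "l \<in> A")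
      case True
      then have "\<forall>\<^sub>F s in at t within f ` A. s < f l"
        using less l x inv by (intro order_tendstoD(2)[OF tendsto_ident_at]) auto
      with ev show ?thesis
        by eventually_elim (use less True inv in auto)
    next
      case False
      then have "y < l" if "y \<in> A" for y
        using mem_is_interval_1_I[OF A x(1) that, of l] l x inv[OF x(1)] by force
      then show ?thesis
        by (intro eventually_mono[OF ev]) (auto simp: inv)
    qed
  qed
qed

section \<open>Functions whose increments are scaled by translations\<close>

text \<open>
  The generator shared by the two types of solutions. Using one symbol for both lets the power and
  the logarithmic case be treated together until the very end.
\<close>

definition exp_or_id :: "real \<Rightarrow> real \<Rightarrow> real" where
  "exp_or_id \<mu> y = (if \<mu> = 0 then y else exp (\<mu> * y))"

lemma inj_exp_or_id: "exp_or_id \<mu> x = exp_or_id \<mu> y \<longleftrightarrow> x = y"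
  by (auto simp: exp_or_id_def)

lemma continuous_on_exp_or_id [continuous_intros]:
  "continuous_on A g \<Longrightarrow> continuous_on A (\<lambda>x. exp_or_id \<mu> (g x))"
  unfolding exp_or_id_def by (cases "\<mu> = 0") (auto intro!: continuous_intros)

text \<open>
  Up to an additive constant and for small \<open>c\<close>, translation by \<open>c\<close> acts on \<open>g\<close> as multiplication by
  \<open>exp (\<mu> c)\<close>. The conditional form leaves out the points that a translation moves out of \<open>A\<close>.
\<close>

definition increments_scale :: "real set \<Rightarrow> real \<Rightarrow> real \<Rightarrow> (real \<Rightarrow> real) \<Rightarrow> bool" where
  "increments_scale A c0 \<mu> g \<longleftrightarrow> (\<forall>c x y. \<bar>c\<bar> < c0 \<longrightarrow> x \<in> A \<longrightarrow> y \<in> A \<longrightarrow> x + c \<in> A \<longrightarrow> y + c \<in> A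
     \<longrightarrow> g (y + c) - g (x + c) = exp (\<mu> * c) * (g y - g x))"

lemma increments_scaleD:
  "\<lbrakk>increments_scale A c0 \<mu> g; \<bar>c\<bar> < c0; x \<in> A; y \<in> A; x + c \<in> A; y + c \<in> A\<rbrakk>
     \<Longrightarrow> g (y + c) - g (x + c) = exp (\<mu> * c) * (g y - g x)"
  by (auto simp: increments_scale_def)

text \<open>
  For \<open>\<mu> = 0\<close> the increments are translation invariant. For \<open>\<mu> \<noteq> 0\<close>, going from \<open>a\<close> to \<open>a + c + c'\<close>
  in the two possible orders gives \<open>D c (exp (\<mu> c') - 1) = D c' (exp (\<mu> c) - 1)\<close> for \<open>D c = g (a + c) - g a\<close>.
  So \<open>D c\<close> is a fixed multiple of \<open>exp (\<mu> c) - 1\<close>, which yields a constant \<open>\<beta>\<close> such that translation by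
  \<open>c\<close> multiplies \<open>g - \<beta>\<close> exactly by \<open>exp (\<mu> c)\<close>. Then \<open>(g y - \<beta>) exp (- \<mu> y)\<close> is locally constant.
\<close>

lemma exp_or_id_if_increments_scale:
  fixes g :: "real \<Rightarrow> real"
  assumes J: "is_interval J" "a \<in> J" "b \<in> J" "a < b"
    and g: "continuous_on J g" and c0: "c0 > 0"
    and scale: "increments_scale J c0 \<mu> g"
  shows "\<exists>\<alpha> \<beta>. \<forall>y\<in>J. g y = \<alpha> * exp_or_id \<mu> y + \<beta>"
proof (cases "\<mu> = 0")
  case True
  have "\<exists>m n. \<forall>x\<in>J. g x = m * x + n"
  proof (rule affine_if_increments_translation_invariant[OF J(1) g c0])
    fix h x y assume "0 < h" "h < c0" "x \<in> J" "x + h \<in> J" "y \<in> J" "y + h \<in> J"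
    then show "g (x + h) - g x = g (y + h) - g y"
      using increments_scaleD[OF scale, of h x y] True by simp
  qed
  with True show ?thesis
    by (simp add: exp_or_id_def)
next
  case False
  define c2 where "c2 = min c0 ((b - a) / 2)"
  have c2: "c2 > 0" "c2 \<le> c0" "c2 \<le> (b - a) / 2"
    using c0 J by (simp_all add: c2_def min_def)
  have mem: "a + x \<in> J" if "0 \<le> x" "x \<le> b - a" for x
    by (rule mem_is_interval_1_I[OF J(1,2,3)]) (use that in auto)
  define D where "D = (\<lambda>c. g (a + c) - g a)"
  have comm: "D c * (exp (\<mu> * c') - 1) = D c' * (exp (\<mu> * c) - 1)"
    if "0 < c" "c < c2" "0 < c'" "c' < c2" for c c'
  proof -
    have "g (a + c + c') - g (a + c') = exp (\<mu> * c') * (g (a + c) - g a)"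
      using increments_scaleD[OF scale, of c' a "a + c"] mem[of 0] mem[of c] mem[of c'] mem[of "c + c'"] that c2
      by (simp add: add.assoc)
    moreover have "g (a + c + c') - g (a + c) = exp (\<mu> * c) * (g (a + c') - g a)"
      using increments_scaleD[OF scale, of c a "a + c'"] mem[of 0] mem[of c] mem[of c'] mem[of "c + c'"] that c2
      by (simp add: ac_simps)
    ultimately show ?thesis
      by (simp add: D_def algebra_simps)
  qed
  define \<gamma> where "\<gamma> = D (c2 / 2) / (exp (\<mu> * (c2 / 2)) - 1)"
  define \<beta> where "\<beta> = g a - \<gamma>"
  have D: "D c = \<gamma> * (exp (\<mu> * c) - 1)" if "0 < c" "c < c2" for c
  proof -
    have "exp (\<mu> * (c2 / 2)) - 1 \<noteq> 0"
      using False c2 by simp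
    then show ?thesis
      using comm[of c "c2 / 2"] that c2 by (simp add: \<gamma>_def field_simps)
  qed
  have shift: "g (y + c) - \<beta> = exp (\<mu> * c) * (g y - \<beta>)"
    if "0 < c" "c < c2" "y \<in> J" "y + c \<in> J" for y c
  proof -
    have "g (y + c) - g (a + c) = exp (\<mu> * c) * (g y - g a)"
      using increments_scaleD[OF scale, of c a y] mem[of c] that J c2 by simp
    then show ?thesis
      using D[of c] that by (simp add: D_def \<beta>_def algebra_simps)
  qed
  define Q where "Q = (\<lambda>y. exp (- (\<mu> * y)) * (g y - \<beta>))"
  have Q_step: "Q (y + c) = Q y" if "0 < c" "c < c2" "y \<in> J" "y + c \<in> J" for y c
  proof -
    have "exp (- (\<mu> * (y + c))) * exp (\<mu> * c) = exp (- (\<mu> * y))"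
      by (simp add: exp_add[symmetric] algebra_simps)
    then show ?thesis
      using shift[OF that] unfolding Q_def by (metis mult.assoc)
  qed
  have "\<exists>\<alpha>. \<forall>y\<in>J. Q y = \<alpha>"
  proof (rule locally_constant_imp_constant[OF J(1)])
    fix x assume x: "x \<in> J"
    have "Q y = Q x" if "y \<in> J" "\<bar>y - x\<bar> < c2" for y
      using Q_step[of "y - x" x] Q_step[of "x - y" y] that x
      by (cases y x rule: linorder_cases) auto
    then show "\<exists>e>0. \<forall>y\<in>J. \<bar>y - x\<bar> < e \<longrightarrow> Q y = Q x"
      using c2 by blast
  qed
  then obtain \<alpha> where "\<And>y. y \<in> J \<Longrightarrow> Q y = \<alpha>"
    by blast
  then have "g y = \<alpha> * exp_or_id \<mu> y + \<beta>" if "y \<in> J" for y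
    using that False by (force simp: Q_def exp_or_id_def exp_minus field_simps)
  then show ?thesis
    by blast
qed

text \<open>
  The slope \<open>m\<close> belonging to the shift \<open>c\<close> is also the factor by which the shift changes the
  increment \<open>d\<close> of \<open>v\<close> over a fixed step. Hence \<open>ln \<circ> d\<close> has translation invariant increments and
  is affine, which makes the slope exponential in \<open>c\<close>.
\<close>

lemma increments_scale_if_shift_affine:
  fixes v :: "real \<Rightarrow> real"
  assumes J: "is_interval J" "a \<in> J" "b \<in> J" "a < b"
    and v: "continuous_on J v" "strict_mono_on J v" and c0: "c0 > 0"
    and aff: "\<And>c. \<bar>c\<bar> < c0 \<Longrightarrow> \<exists>m n. \<forall>y\<in>J. y + c \<in> J \<longrightarrow> v (y + c) = m * v y + n"
  obtains \<mu> c1 where "c1 > 0" "increments_scale J c1 \<mu> v"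
proof -
  \<comment> \<open>Shifting the middle third of \<open>[a, b]\<close> by at most \<open>L\<close> stays within \<open>[a, b]\<close>.\<close>
  define L where "L = (b - a) / 3"
  have L: "L > 0" "b = a + 3 * L"
    using J by (simp_all add: L_def field_simps)
  have mem: "a + x \<in> J" if "0 \<le> x" "x \<le> 3 * L" for x
    by (rule mem_is_interval_1_I[OF J(1,2,3)]) (use that L in auto)
  define d where "d = (\<lambda>c. v (a + (2 * L + c)) - v (a + (L + c)))"
  have d_pos: "d c > 0" if "c \<in> {-L..L}" for c
    unfolding d_def using strict_mono_onD[OF v(2), of "a + (L + c)" "a + (2 * L + c)"]
      mem[of "L + c"] mem[of "2 * L + c"] that L by auto
  have d_cont: "continuous_on {-L..L} d"
    unfolding d_def
    by (intro continuous_intros continuous_on_compose2[OF v(1)]) (auto intro!: mem)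
  have d_shift: "\<exists>m. \<forall>c\<in>{-L..L}. c + h \<in> {-L..L} \<longrightarrow> d (c + h) = m * d c" if "\<bar>h\<bar> < c0" for h
  proof -
    from aff[OF that] obtain m n where mn: "\<And>y. y \<in> J \<Longrightarrow> y + h \<in> J \<Longrightarrow> v (y + h) = m * v y + n"
      by blast
    have "d (c + h) = m * d c" if "c \<in> {-L..L}" "c + h \<in> {-L..L}" for c
      using mn[of "a + (2 * L + c)"] mn[of "a + (L + c)"] mem[of "2 * L + c"] mem[of "L + c"]
        mem[of "2 * L + c + h"] mem[of "L + c + h"] that
      by (simp add: d_def algebra_simps)
    then show ?thesis
      by blast
  qed
  have "\<exists>\<mu> n. \<forall>c\<in>{-L..L}. ln (d c) = \<mu> * c + n"
  proof (rule affine_if_increments_translation_invariant[OF _ _ c0])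
    show "continuous_on {-L..L} (\<lambda>c. ln (d c))"
      by (intro continuous_on_ln d_cont) (use d_pos in force)
    fix h x y assume *: "0 < h" "h < c0" "x \<in> {-L..L}" "x + h \<in> {-L..L}" "y \<in> {-L..L}" "y + h \<in> {-L..L}"
    obtain m where "\<forall>c\<in>{-L..L}. c + h \<in> {-L..L} \<longrightarrow> d (c + h) = m * d c"
      using d_shift[of h] * by auto
    with * have m: "d (x + h) = m * d x" "d (y + h) = m * d y"
      by blast+
    moreover have "m > 0"
      using m d_pos * by (metis zero_less_mult_pos2)
    ultimately show "ln (d (x + h)) - ln (d x) = ln (d (y + h)) - ln (d y)"
      using d_pos * by (simp add: ln_mult_pos)
  qed (auto simp: is_interval_cc)
  then obtain \<mu> n where ln_d: "\<And>c. c \<in> {-L..L} \<Longrightarrow> ln (d c) = \<mu> * c + n"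
    by blast
  show ?thesis
  proof (rule that[of "min c0 L" \<mu>])
    show "min c0 L > 0"
      using c0 L by simp
    show "increments_scale J (min c0 L) \<mu> v"
      unfolding increments_scale_def
    proof (intro allI impI)
      fix c y y' assume c: "\<bar>c\<bar> < min c0 L" and y: "y \<in> J" "y' \<in> J" "y + c \<in> J" "y' + c \<in> J"
      from c aff[of c] obtain m n' where mn: "\<And>y. y \<in> J \<Longrightarrow> y + c \<in> J \<Longrightarrow> v (y + c) = m * v y + n'"
        by auto
      have "c \<in> {-L..L}" "0 \<in> {-L..L}"
        using c L by auto
      then have "d c = exp (\<mu> * c) * d 0"
        using ln_d[of c] ln_d[of 0] d_pos by (metis add_0 exp_add exp_ln mult_zero_right)
      moreover have "d c = m * d 0"
      proof -
        have "a + 2 * L \<in> J" "a + L \<in> J" "a + 2 * L + c \<in> J" "a + L + c \<in> J"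
          using mem[of "2 * L"] mem[of L] mem[of "2 * L + c"] mem[of "L + c"] c L
          by (auto simp: add.assoc)
        then show ?thesis
          using mn[of "a + 2 * L"] mn[of "a + L"] by (simp add: d_def algebra_simps)
      qed
      ultimately have "m = exp (\<mu> * c)"
        using d_pos[of 0] L by auto
      then show "v (y' + c) - v (y + c) = exp (\<mu> * c) * (v y' - v y)"
        using mn[of y] mn[of y'] y by (simp add: algebra_simps)
    qed
  qed
qed

section \<open>The equation in logarithmic coordinates\<close>

text \<open>
  Neither \<open>k\<close> nor \<open>\<phi>\<close> is assumed continuous, since they come from inverses of functions whose
  domains may have gaps. For the same reason \<open>f\<close> is known to be continuous only along each slice
  \<open>J + k s\<close>, and slices for different \<open>s\<close> need not overlap.
\<close>

locale log_family =
  fixes J S :: "real set" and v k \<phi> f :: "real \<Rightarrow> real" and r :: real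
  assumes J: "interval_of_positive_length J" and S: "interval_of_positive_length S"
    and v_cont: "continuous_on J v" and v_mono: "strict_mono_on J v"
    and k_mono: "strict_mono_on S k"
    and phi_mono: "strict_mono_on {s + v y |s y. s \<in> S \<and> y \<in> J} \<phi>"
    and f_cont: "s \<in> S \<Longrightarrow> continuous_on J (\<lambda>y. f (y + k s))"
    and phi_eq: "\<lbrakk>s \<in> S; y \<in> J\<rbrakk> \<Longrightarrow> \<phi> (s + v y) = r * y + f (y + k s)"
    and r_nonzero: "r \<noteq> 0"
begin

lemma J_interval: "is_interval J" and S_interval: "is_interval S"
  using J S by (auto simp: interval_of_positive_length_def)

lemmas J_mem = mem_is_interval_1_I[OF J_interval]
lemmas S_mem = mem_is_interval_1_I[OF S_interval]

lemma v_less: "y \<in> J \<Longrightarrow> y' \<in> J \<Longrightarrow> v y < v y' \<longleftrightarrow> y < y'"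
  using v_mono by (simp add: strict_mono_on_less)

lemma v_le: "y \<in> J \<Longrightarrow> y' \<in> J \<Longrightarrow> v y \<le> v y' \<longleftrightarrow> y \<le> y'"
  using v_less by (meson not_le)

lemma k_less: "s \<in> S \<Longrightarrow> s' \<in> S \<Longrightarrow> k s < k s' \<longleftrightarrow> s < s'"
  using k_mono by (simp add: strict_mono_on_less)

lemma k_le: "s \<in> S \<Longrightarrow> s' \<in> S \<Longrightarrow> k s \<le> k s' \<longleftrightarrow> s \<le> s'"
  using k_less by (meson not_le)

lemma phi_less:
  "\<lbrakk>s \<in> S; y \<in> J; s' \<in> S; y' \<in> J\<rbrakk> \<Longrightarrow> \<phi> (s + v y) < \<phi> (s' + v y') \<longleftrightarrow> s + v y < s' + v y'"
  by (rule strict_mono_on_less[OF phi_mono]) auto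

lemma phi_eq_iff:
  "\<lbrakk>s \<in> S; y \<in> J; s' \<in> S; y' \<in> J\<rbrakk> \<Longrightarrow> \<phi> (s + v y) = \<phi> (s' + v y') \<longleftrightarrow> s + v y = s' + v y'"
  by (rule strict_mono_on_eq[OF phi_mono]) auto

lemma v_onto:
  assumes "y \<in> J" "y' \<in> J" "v y \<le> b" "b \<le> v y'" "y \<le> y'"
  obtains x where "y \<le> x" "x \<le> y'" "x \<in> J" "v x = b"
proof -
  have sub: "{y..y'} \<subseteq> J"
    using J_mem[OF assms(1,2)] by auto
  then obtain x where "y \<le> x" "x \<le> y'" "v x = b"
    using IVT'[of v y b y'] assms continuous_on_subset[OF v_cont sub] by auto
  with sub that show ?thesis
    by auto
qed

lemma phi_v_cont: "s \<in> S \<Longrightarrow> continuous_on J (\<lambda>y. \<phi> (s + v y))"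
  by (rule continuous_on_eq[of J "\<lambda>y. r * y + f (y + k s)"])
    (auto intro!: continuous_intros f_cont simp: phi_eq)

text \<open>
  Both sides have the same argument \<open>y + k s\<close> of \<open>f\<close>.
\<close>

lemma phi_shift:
  assumes "s \<in> S" "s' \<in> S" "k s' = k s - c" "y \<in> J" "y + c \<in> J"
  shows "\<phi> (s' + v (y + c)) = \<phi> (s + v y) + r * c"
  using phi_eq[OF assms(1,4)] phi_eq[OF assms(2,5)] assms(3) by (simp add: algebra_simps)

text \<open>
  On \<open>[p, q]\<close> the increments of \<open>k\<close> are below \<open>d\<close>, so the slices \<open>[y - d, y + d] + k s\<close> share an
  interval \<open>[a, b]\<close> containing all \<open>y + k s\<close>. Comparing two parameters \<open>p' < q'\<close> at the same \<open>y\<close>, the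
  equation gives \<open>f z < f (z + c)\<close> on this whole interval for \<open>c = k q' - k p'\<close>, and \<open>c\<close> can be
  made arbitrarily small. Thus \<open>f\<close> is strictly increasing on \<open>[a, b]\<close>. On the other hand, the values
  \<open>f (y + k s) = \<phi> (s + v y) - r y\<close> leave no gap as \<open>s\<close> varies: the bound on \<open>q - p\<close> keeps \<open>s + v y\<close>
  within \<open>p + v ` J\<close>, where \<open>\<phi>\<close> is continuous. So \<open>k\<close> leaves no gap either.
\<close>

lemma k_fills_interval:
  assumes d: "d > 0" "y - d \<in> J" "y + d \<in> J"
    and pq: "p \<in> S" "q \<in> S" "p < q" and k_osc: "k q - k p < d" and pq_close: "q - p \<le> v (y + d) - v y"
  shows "{k p..k q} \<subseteq> k ` {p..q}"
proof
  fix z assume z: "z \<in> {k p..k q}"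
  define a b where "a = y - d + k q" and "b = y + d + k p"
  have k_pq: "k p < k q"
    using pq k_less by simp
  have S': "{p..q} \<subseteq> S"
    using S_mem[OF pq(1,2)] by auto
  have J': "{y - d..y + d} \<subseteq> J"
    using J_mem[OF d(2,3)] by auto
  have y: "y \<in> J"
    using J' d by auto
  have "continuous_on {a..b} (\<lambda>z. f (z - k p + k p))"
    by (rule continuous_on_compose2[OF f_cont[OF pq(1)], where f = "\<lambda>z. z - k p"])
      (use J' k_pq in \<open>auto intro!: continuous_intros simp: a_def b_def\<close>)
  then have f_ab: "continuous_on {a..b} f"
    by simp
  have "strict_mono_on {a..b} f"
  proof (rule strict_mono_on_if_arbitrarily_small_steps_increase[OF f_ab])
    fix \<eta> :: real assume "\<eta> > 0"
    then obtain p' q' where p'q': "p \<le> p'" "p' < q'" "q' \<le> q" and small: "k q' - k p' < \<eta>"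
      using small_increment_on_subinterval pq(3) by blast
    have S'': "p' \<in> S" "q' \<in> S"
      using p'q' S' by auto
    then have k': "k p \<le> k p'" "k p' < k q'" "k q' \<le> k q"
      using p'q' pq k_less k_le by auto
    have "f z < f (z + (k q' - k p'))" if "a \<le> z" "z + (k q' - k p') \<le> b" for z
    proof -
      have *: "z - k p' \<in> J"
        using J' that k' by (auto simp: a_def b_def)
      have "\<phi> (p' + v (z - k p')) < \<phi> (q' + v (z - k p'))"
        using phi_less * S'' p'q' by simp
      then show ?thesis
        using phi_eq[OF S''(1) *] phi_eq[OF S''(2) *] by (simp add: algebra_simps)
    qed
    then show "\<exists>c. 0 < c \<and> c < \<eta> \<and> (\<forall>z. a \<le> z \<and> z + c \<le> b \<longrightarrow> f z < f (z + c))"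
      using small k' by (intro exI[of _ "k q' - k p'"]) auto
  qed
  then have f_mono: "f x \<le> f x' \<longleftrightarrow> x \<le> x'" "f x = f x' \<longleftrightarrow> x = x'"
    if "x \<in> {a..b}" "x' \<in> {a..b}" for x x'
    using that by (auto simp: strict_mono_on_less_eq strict_mono_on_eq)
  have in_ab: "y + x \<in> {a..b}" if "x \<in> {k p..k q}" for x
    using that k_osc by (auto simp: a_def b_def)
  define val where "val = r * y + f (y + z)"
  \<comment> \<open>Varying \<open>s\<close> from \<open>p\<close> to \<open>q\<close> at \<open>y\<close> is replaced by varying \<open>y\<close> to \<open>y1\<close> at the parameter \<open>p\<close>.\<close>
  obtain y1 where y1: "y \<le> y1" "y1 \<in> J" "v y1 = v y + (q - p)"
    using v_onto[of y "y + d" "v y + (q - p)"] y d pq pq_close by auto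
  have "\<phi> (p + v y) \<le> val"
    using f_mono(1)[OF in_ab in_ab, of "k p" z] z phi_eq[OF pq(1) y] by (simp add: val_def)
  moreover have "val \<le> \<phi> (p + v y1)"
    using f_mono(1)[OF in_ab in_ab, of z "k q"] z phi_eq[OF pq(2) y] y1 by (simp add: val_def algebra_simps)
  moreover have sub: "{y..y1} \<subseteq> J"
    using J_mem[OF y y1(2)] by auto
  ultimately obtain y2 where y2: "y \<le> y2" "y2 \<le> y1" "\<phi> (p + v y2) = val"
    using IVT'[of "\<lambda>y. \<phi> (p + v y)" y val y1] y1 continuous_on_subset[OF phi_v_cont[OF pq(1)] sub] by blast
  have "y2 \<in> J"
    using y2 sub by auto
  define s where "s = p + v y2 - v y"
  have s: "s \<in> {p..q}"
    using v_le[of y y2] v_le[of y2 y1] y y1 y2 \<open>y2 \<in> J\<close> by (auto simp: s_def)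
  then have "s \<in> S"
    using S' by auto
  have "k s \<in> {k p..k q}"
    using k_le s \<open>s \<in> S\<close> pq by auto
  moreover have "f (y + k s) = f (y + z)"
    using phi_eq[OF \<open>s \<in> S\<close> y] y2(3) by (simp add: s_def val_def)
  ultimately have "k s = z"
    using f_mono(2)[OF in_ab in_ab, of "k s" z] z by simp
  with s show "z \<in> k ` {p..q}"
    by blast
qed

text \<open>
  Bisection makes the increment of \<open>k\<close> smaller than \<open>d\<close>, whatever jumps \<open>k\<close> has near \<open>s\<close>. The
  interval need not contain \<open>s\<close> itself.
\<close>

lemma k_fills_nearby_interval:
  assumes s: "s \<in> S" and d: "d > 0" "y - d \<in> J" "y + d \<in> J" and e: "e > 0"
  obtains p q where "p \<in> S" "q \<in> S" "p < q" "\<bar>p - s\<bar> < e" "\<bar>q - s\<bar> < e" "k q - k p < d"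
    "{k p..k q} \<subseteq> k ` {p..q}"
proof -
  have y: "y \<in> J"
    using J_mem[OF d(2,3), of y] d(1) by simp
  define e' where "e' = min e ((v (y + d) - v y) / 2)"
  have e': "e' > 0" "e' \<le> e" "2 * e' \<le> v (y + d) - v y"
    using e v_less[OF y d(3)] d by (simp_all add: e'_def min_def)
  obtain a b where ab: "a \<in> S" "b \<in> S" "a < b"
    using S by (auto simp: interval_of_positive_length_def)
  have near: "\<exists>p0 q0. p0 \<in> S \<and> q0 \<in> S \<and> p0 < q0 \<and> s - e' < p0 \<and> q0 < s + e'"
  proof (cases "s < b")
    case True
    then show ?thesis
      using s ab e' S_mem[OF s ab(2), of "min b (s + e' / 2)"]
      by (intro exI[of _ s] exI[of _ "min b (s + e' / 2)"]) auto
  next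
    case False
    then show ?thesis
      using s ab e' S_mem[OF ab(1) s, of "max a (s - e' / 2)"]
      by (intro exI[of _ "max a (s - e' / 2)"] exI[of _ s]) auto
  qed
  then obtain p0 q0 where p0q0: "p0 \<in> S" "q0 \<in> S" "p0 < q0" "s - e' < p0" "q0 < s + e'"
    by blast
  obtain p q where pq: "p0 \<le> p" "p < q" "q \<le> q0" "k q - k p < d"
    using small_increment_on_subinterval[OF p0q0(3) d(1)] by blast
  have mem: "p \<in> S" "q \<in> S"
    using pq S_mem[OF p0q0(1,2), of p] S_mem[OF p0q0(1,2), of q] by auto
  have "q - p \<le> v (y + d) - v y"
    using pq p0q0 e' by linarith
  with that[OF mem pq(2) _ _ pq(4)] k_fills_interval[OF d mem pq(2,4)] show ?thesis
    using pq p0q0 e' by auto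
qed

text \<open>
  Let \<open>K s\<close> be the parameter with \<open>k (K s) = k s - c\<close>; it exists for \<open>s\<close> in a nondegenerate interval
  \<open>[\<sigma>, \<tau>]\<close>. By \<open>phi_shift\<close> and injectivity of \<open>\<phi>\<close>, the sum \<open>K s + v (y + c)\<close> depends on
  \<open>s + v y\<close> only. Trading an increase \<open>h\<close> of \<open>s\<close> for the same increase of \<open>v y\<close> shows that the
  increment of \<open>v (y + c)\<close>, as a function of \<open>v y\<close>, equals \<open>K (\<sigma> + h) - K \<sigma>\<close> wherever it is taken.
\<close>

lemma v_shift_affine:
  assumes pq: "p \<in> S" "q \<in> S" "p < q"
    and onto: "{k p..k q} \<subseteq> k ` {p..q}"
    and c: "\<bar>c\<bar> < k q - k p"
  shows "\<exists>m n. \<forall>y\<in>J. y + c \<in> J \<longrightarrow> v (y + c) = m * v y + n"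
proof -
  have S': "{p..q} \<subseteq> S"
    using S_mem[OF pq(1,2)] by auto
  obtain \<sigma> \<tau> where \<sigma>\<tau>: "\<sigma> \<in> {p..q}" "\<tau> \<in> {p..q}" "\<sigma> < \<tau>" "k p \<le> k \<sigma> - c" "k \<tau> - c \<le> k q"
  proof (cases "c \<ge> 0")
    case True
    then have "k p + c \<in> {k p..k q}"
      using c by auto
    then obtain \<sigma> where \<sigma>: "\<sigma> \<in> {p..q}" "k \<sigma> = k p + c"
      using onto by (metis imageE subsetD)
    moreover have "\<sigma> \<in> S"
      using S' \<sigma>(1) by blast
    ultimately have "\<sigma> < q"
      using k_less[of \<sigma> q] c pq by auto
    with True show ?thesis
      using that[of \<sigma> q] \<sigma> pq by auto
  next
    case False
    then have "k q + c \<in> {k p..k q}"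
      using c by auto
    then obtain \<tau> where \<tau>: "\<tau> \<in> {p..q}" "k \<tau> = k q + c"
      using onto by (metis imageE subsetD)
    moreover have "\<tau> \<in> S"
      using S' \<tau>(1) by blast
    ultimately have "p < \<tau>"
      using k_less[of p \<tau>] c pq by auto
    with False show ?thesis
      using that[of p \<tau>] \<tau> pq by auto
  qed
  have "\<exists>s'. s' \<in> S \<and> k s' = k s - c" if "s \<in> {\<sigma>..\<tau>}" for s
  proof -
    have "\<sigma> \<in> S" "\<tau> \<in> S" "s \<in> S"
      using \<sigma>\<tau> that S' by auto
    then have "k s - c \<in> {k p..k q}"
      using k_le[of \<sigma> s] k_le[of s \<tau>] that \<sigma>\<tau>(4,5) by auto
    then show ?thesis
      using onto S' by (metis imageE subsetD)
  qed
  then obtain K where K: "\<And>s. s \<in> {\<sigma>..\<tau>} \<Longrightarrow> K s \<in> S \<and> k (K s) = k s - c"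
    by metis
  define Jc where "Jc = {y \<in> J. y + c \<in> J}"
  have Jc: "is_interval Jc"
    unfolding is_interval_1
  proof (intro ballI allI impI)
    fix a b x assume "a \<in> Jc" "b \<in> Jc" "a \<le> x \<and> x \<le> b"
    then show "x \<in> Jc"
      using J_mem[of a b x] J_mem[of "a + c" "b + c" "x + c"] by (simp add: Jc_def)
  qed
  have Jc_sub: "Jc \<subseteq> J"
    by (auto simp: Jc_def)
  have vJc: "is_interval (v ` Jc)" "strict_mono_on Jc v"
  proof -
    have "connected (v ` Jc)"
      using Jc continuous_on_subset[OF v_cont Jc_sub]
      by (intro connected_continuous_image) (auto simp: is_interval_connected_1)
    then show "is_interval (v ` Jc)"
      by (simp add: is_interval_connected_1)
    show "strict_mono_on Jc v"
      using v_mono Jc_sub by (auto simp: strict_mono_on_def)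
  qed
  \<comment> \<open>\<open>v (y + c)\<close> as a function of \<open>v y\<close>\<close>
  define W where "W = (\<lambda>b. v (inv_into Jc v b + c))"
  have W: "W (v y) = v (y + c)" if "y \<in> Jc" for y
    using that strict_mono_on_imp_inj_on[OF vJc(2)] by (simp add: W_def)
  have "\<exists>m n. \<forall>b\<in>v ` Jc. W b = m * b + n"
  proof (rule affine_if_increments_translation_invariant[OF vJc(1)])
    show "continuous_on (v ` Jc) W"
      unfolding W_def
    proof (rule continuous_on_compose2[OF v_cont])
      show "continuous_on (v ` Jc) (\<lambda>b. inv_into Jc v b + c)"
        by (intro continuous_intros continuous_on_inverse_strict_mono Jc vJc)
      show "(\<lambda>b. inv_into Jc v b + c) ` v ` Jc \<subseteq> J"
        using strict_mono_on_imp_inj_on[OF vJc(2)] by (auto simp: Jc_def)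
    qed
    show "0 < \<tau> - \<sigma>"
      using \<sigma>\<tau> by simp
    fix h b b' assume h: "0 < h" "h < \<tau> - \<sigma>"
      and b: "b \<in> v ` Jc" "b + h \<in> v ` Jc" "b' \<in> v ` Jc" "b' + h \<in> v ` Jc"
    have incr: "W (b + h) - W b = K (\<sigma> + h) - K \<sigma>" if "b \<in> v ` Jc" "b + h \<in> v ` Jc" for b
    proof -
      from that obtain y y' where y: "y \<in> Jc" "b = v y" "y' \<in> Jc" "b + h = v y'"
        by blast
      have mem: "\<sigma> \<in> S" "\<sigma> + h \<in> S" "y \<in> J" "y' \<in> J" "y + c \<in> J" "y' + c \<in> J"
        using \<sigma>\<tau> h S' y by (auto simp: Jc_def)
      have "\<phi> (K (\<sigma> + h) + v (y + c)) = \<phi> (\<sigma> + h + v y) + r * c"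
        using phi_shift mem K[of "\<sigma> + h"] h by simp
      also have "\<sigma> + h + v y = \<sigma> + v y'"
        using y by simp
      also have "\<phi> (\<sigma> + v y') + r * c = \<phi> (K \<sigma> + v (y' + c))"
        using phi_shift mem K[of \<sigma>] h by simp
      finally have "K (\<sigma> + h) + v (y + c) = K \<sigma> + v (y' + c)"
        using phi_eq_iff mem K[of \<sigma>] K[of "\<sigma> + h"] h by simp
      then show ?thesis
        using W[OF y(1)] W[OF y(3)] y by simp
    qed
    from incr[OF b(1,2)] incr[OF b(3,4)] show "W (b + h) - W b = W (b' + h) - W b'"
      by simp
  qed
  then obtain m n where mn: "\<And>b. b \<in> v ` Jc \<Longrightarrow> W b = m * b + n"
    by blast
  have "v (y + c) = m * v y + n" if "y \<in> J" "y + c \<in> J" for y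
    using mn[of "v y"] W[of y] that by (simp add: Jc_def)
  then show ?thesis
    by blast
qed

lemma v_increments_scale:
  obtains \<mu> c1 where "c1 > 0" "increments_scale J c1 \<mu> v"
proof -
  obtain a b where ab: "a \<in> J" "b \<in> J" "a < b"
    using J by (auto simp: interval_of_positive_length_def)
  obtain s where s: "s \<in> S"
    using S by (auto simp: interval_of_positive_length_def)
  have "(b - a) / 2 > 0" "(a + b) / 2 - (b - a) / 2 \<in> J" "(a + b) / 2 + (b - a) / 2 \<in> J"
    using ab by (simp_all add: field_simps)
  then obtain p q where pq: "p \<in> S" "q \<in> S" "p < q"
    and onto: "{k p..k q} \<subseteq> k ` {p..q}"
    using k_fills_nearby_interval[OF s _ _ _ zero_less_one] by metis
  have kpq: "k q - k p > 0"
    using k_less pq by simp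
  show thesis
    by (rule increments_scale_if_shift_affine[OF J_interval ab v_cont v_mono kpq v_shift_affine[OF pq onto]])
      (auto intro: that)
qed

text \<open>
  The parameter \<open>s\<close> is moved to a point \<open>s0\<close> inside an interval that \<open>k\<close> maps onto an interval;
  the argument \<open>s + v y\<close> stays in the neighbourhood \<open>U = s0 + v ` Y\<close>. For small \<open>h\<close> there is
  \<open>s'\<close> with \<open>k s' = k s0 - h\<close>, and \<open>phi_shift\<close> says that the local inverse \<open>\<psi>\<close> of \<open>\<phi>\<close> sends
  \<open>\<tau> = \<phi> (s0 + v x)\<close> to \<open>s0 + v x\<close> and \<open>\<tau> + r h\<close> to \<open>s' + v (x + h)\<close>. So \<open>\<psi>\<close> inherits the scaling of
  increments from \<open>v\<close>, with the translation stretched by the factor \<open>r\<close>.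
\<close>

lemma phi_locally_affine:
  assumes c1: "c1 > 0"
    and scale: "increments_scale J c1 \<mu> v"
    and s: "s \<in> S" and y: "y \<in> interior J"
  shows "\<exists>U m n. open U \<and> s + v y \<in> U \<and> U \<subseteq> {s + b |s b. s \<in> S \<and> b \<in> v ` interior J}
    \<and> (\<forall>t\<in>U. exp_or_id (\<mu> / r) (\<phi> t) = m * t + n)"
proof -
  obtain e where e: "e > 0" "ball y e \<subseteq> J"
    using y mem_interior by blast
  define d where "d = e / 3"
  have d: "d > 0"
    using e by (simp add: d_def)
  have Jd: "x \<in> J" if "\<bar>x - y\<bar> \<le> 2 * d" for x
  proof -
    have "x \<in> ball y e"
      using that e unfolding mem_ball dist_real_def d_def by linarith
    with e show ?thesis
      by blast
  qed
  have mem: "y - d \<in> J" "y \<in> J" "y + d \<in> J"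
    using Jd d by auto
  define e' where "e' = min (v (y + d) - v y) (v y - v (y - d))"
  have e': "e' > 0" "e' \<le> v (y + d) - v y" "e' \<le> v y - v (y - d)"
    using v_less[OF mem(1,2)] v_less[OF mem(2,3)] d by (simp_all add: e'_def)
  obtain p q where pq: "p \<in> S" "q \<in> S" "p < q" "\<bar>p - s\<bar> < e'" "\<bar>q - s\<bar> < e'"
    and onto: "{k p..k q} \<subseteq> k ` {p..q}"
    using k_fills_nearby_interval[OF s d mem(1,3) e'(1)] by metis
  define s0 where "s0 = (p + q) / 2"
  have s0: "p < s0" "s0 < q"
    using pq(3) by (simp_all add: s0_def)
  have s0_near: "\<bar>s0 - s\<bar> < e'"
    using pq s0 by linarith
  have S': "{p..q} \<subseteq> S"
    using S_mem[OF pq(1,2)] by auto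
  have s0S: "s0 \<in> S"
    using S' s0 by auto
  have k0: "k p < k s0" "k s0 < k q"
    using k_less s0 s0S pq by auto
  define Y where "Y = {y - d<..<y + d}"
  have Y: "Y \<subseteq> J"
    using Jd by (auto simp: Y_def)
  have Y_int: "Y \<subseteq> interior J"
    using Y by (simp add: interior_maximal Y_def)
  define U where "U = (\<lambda>y. s0 + v y) ` Y"
  have U_eq: "U = {s0 + v (y - d)<..<s0 + v (y + d)}"
  proof
    show "U \<subseteq> {s0 + v (y - d)<..<s0 + v (y + d)}"
      using v_less mem Y by (auto simp: U_def Y_def)
    show "{s0 + v (y - d)<..<s0 + v (y + d)} \<subseteq> U"
    proof
      fix t assume t: "t \<in> {s0 + v (y - d)<..<s0 + v (y + d)}"
      then obtain x where x: "y - d \<le> x" "x \<le> y + d" "v x = t - s0"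
        using v_onto[of "y - d" "y + d" "t - s0"] mem d by auto
      with t have "x \<in> Y"
        unfolding Y_def by (cases "x = y - d"; cases "x = y + d") auto
      then show "t \<in> U"
        using x by (auto simp: U_def intro!: image_eqI[of _ _ x])
    qed
  qed
  have U_sub: "U \<subseteq> {s + v y |s y. s \<in> S \<and> y \<in> J}"
    using s0S Y by (auto simp: U_def)
  have U: "is_interval U" "strict_mono_on U \<phi>"
    using U_sub phi_mono by (auto simp: U_eq is_interval_oo strict_mono_on_def subset_iff)
  define \<psi> where "\<psi> = inv_into U \<phi>"
  have \<psi>: "\<psi> (\<phi> t) = t" if "t \<in> U" for t
    using that U(2) by (simp add: \<psi>_def strict_mono_on_imp_inj_on)
  have \<psi>_cont: "continuous_on (\<phi> ` U) \<psi>"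
    unfolding \<psi>_def by (rule continuous_on_inverse_strict_mono[OF U])
  have phi_U: "is_interval (\<phi> ` U)"
  proof -
    have "connected ((\<lambda>y. \<phi> (s0 + v y)) ` Y)"
      using continuous_on_subset[OF phi_v_cont[OF s0S] Y] by (intro connected_continuous_image) (auto simp: Y_def)
    then show ?thesis
      by (simp add: is_interval_connected_1 U_def image_image)
  qed
  obtain t1 t2 where t12: "t1 \<in> U" "t2 \<in> U" "t1 < t2"
  proof -
    have "s0 + v (y - d) < s0 + v (y + d)"
      using v_less[OF mem(1,3)] d by simp
    then obtain t1 where t1: "s0 + v (y - d) < t1" "t1 < s0 + v (y + d)"
      using dense by blast
    then obtain t2 where "t1 < t2" "t2 < s0 + v (y + d)"
      using dense by blast
    with t1 show ?thesis
      using that[of t1 t2] by (auto simp: U_eq)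
  qed
  have phi_t12: "\<phi> t1 < \<phi> t2"
    using U(2) t12 by (simp add: strict_mono_on_def)
  define c2 where "c2 = min (min c1 d) (min (k s0 - k p) (k q - k s0))"
  have c2: "c2 > 0" "c2 \<le> c1" "c2 \<le> d" "c2 \<le> k s0 - k p" "c2 \<le> k q - k s0"
    using c1 d k0 by (simp_all add: c2_def)
  have "\<exists>\<alpha> \<beta>. \<forall>\<tau>\<in>\<phi> ` U. \<psi> \<tau> = \<alpha> * exp_or_id (\<mu> / r) \<tau> + \<beta>"
  proof (rule exp_or_id_if_increments_scale[OF phi_U imageI[OF t12(1)] imageI[OF t12(2)] phi_t12 \<psi>_cont])
    show "\<bar>r\<bar> * c2 > 0"
      using c2 r_nonzero by simp
    show "increments_scale (\<phi> ` U) (\<bar>r\<bar> * c2) (\<mu> / r) \<psi>"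
      unfolding increments_scale_def
    proof (intro allI impI)
      fix c \<tau> \<tau>'
      assume c: "\<bar>c\<bar> < \<bar>r\<bar> * c2"
        and \<tau>: "\<tau> \<in> \<phi> ` U" "\<tau>' \<in> \<phi> ` U" "\<tau> + c \<in> \<phi> ` U" "\<tau>' + c \<in> \<phi> ` U"
      define h where "h = c / r"
      have c_h: "c = r * h"
        using r_nonzero by (simp add: h_def)
      have h: "\<bar>h\<bar> < c2"
        using c r_nonzero by (simp add: c_h abs_mult)
      have "k s0 - h \<in> {k p..k q}"
        using h c2 unfolding atLeastAtMost_iff by linarith
      then obtain s' where s': "s' \<in> S" "k s' = k s0 - h"
        using onto S' by (metis imageE subsetD)
      have \<psi>_pair: "\<exists>x\<in>J. x + h \<in> J \<and> \<psi> \<tau> = s0 + v x \<and> \<psi> (\<tau> + c) = s' + v (x + h)"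
        if "\<tau> \<in> \<phi> ` U" "\<tau> + c \<in> \<phi> ` U" for \<tau>
      proof -
        from that obtain x x' where x: "x \<in> Y" "\<tau> = \<phi> (s0 + v x)" "x' \<in> Y" "\<tau> + c = \<phi> (s0 + v x')"
          by (auto simp: U_def)
        have xJ: "x \<in> J" "x' \<in> J" "x + h \<in> J"
          using x Y Jd[of "x + h"] h c2 by (auto simp: Y_def)
        have "\<phi> (s0 + v x') = \<phi> (s' + v (x + h))"
          using phi_shift[OF s0S s' xJ(1,3)] x by (simp add: c_h)
        then have "s0 + v x' = s' + v (x + h)"
          using phi_eq_iff s0S s' xJ by simp
        moreover have "\<psi> \<tau> = s0 + v x" "\<psi> (\<tau> + c) = s0 + v x'"
          using x \<psi> by (auto simp: U_def)
        ultimately show ?thesis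
          using xJ by auto
      qed
      obtain x where x: "x \<in> J" "x + h \<in> J" "\<psi> \<tau> = s0 + v x" "\<psi> (\<tau> + c) = s' + v (x + h)"
        using \<psi>_pair[OF \<tau>(1,3)] by blast
      obtain x' where x': "x' \<in> J" "x' + h \<in> J" "\<psi> \<tau>' = s0 + v x'" "\<psi> (\<tau>' + c) = s' + v (x' + h)"
        using \<psi>_pair[OF \<tau>(2,4)] by blast
      show "\<psi> (\<tau>' + c) - \<psi> (\<tau> + c) = exp (\<mu> / r * c) * (\<psi> \<tau>' - \<psi> \<tau>)"
        using increments_scaleD[OF scale, of h x x'] h c2 x x' r_nonzero by (simp add: c_h)
    qed
  qed
  then obtain \<alpha> \<beta> where \<alpha>\<beta>: "\<And>\<tau>. \<tau> \<in> \<phi> ` U \<Longrightarrow> \<psi> \<tau> = \<alpha> * exp_or_id (\<mu> / r) \<tau> + \<beta>"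
    by blast
  have affine: "t = \<alpha> * exp_or_id (\<mu> / r) (\<phi> t) + \<beta>" if "t \<in> U" for t
    using \<alpha>\<beta>[of "\<phi> t"] \<psi>[OF that] that by simp
  have "\<alpha> \<noteq> 0"
    using affine[OF t12(1)] affine[OF t12(2)] t12(3) by auto
  then have "exp_or_id (\<mu> / r) (\<phi> t) = (1 / \<alpha>) * t + (- \<beta> / \<alpha>)" if "t \<in> U" for t
    using affine[OF that] by (simp add: field_simps)
  moreover have "open U"
    by (simp add: U_eq)
  moreover have "s + v y \<in> U"
    using s0_near e' by (auto simp: U_eq)
  moreover have "U \<subseteq> {s + b |s b. s \<in> S \<and> b \<in> v ` interior J}"
    using Y_int s0S by (auto simp: U_def)
  ultimately show ?thesis
    by blast
qed

text \<open>
  The local forms of \<open>\<phi>\<close> fit together on the open interval \<open>T = S + v ` interior J\<close>. The values at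
  end points of \<open>J\<close> follow because \<open>\<phi> (s + v y)\<close> is continuous in \<open>y\<close> for each \<open>s\<close>.
\<close>

lemma representation:
  obtains \<mu> \<alpha> \<beta> m n where "m \<noteq> 0"
    "\<And>y. y \<in> J \<Longrightarrow> v y = \<alpha> * exp_or_id \<mu> y + \<beta>"
    "\<And>s y. \<lbrakk>s \<in> S; y \<in> J\<rbrakk> \<Longrightarrow> exp_or_id (\<mu> / r) (\<phi> (s + v y)) = m * (s + v y) + n"
proof -
  obtain a b where ab: "a \<in> J" "b \<in> J" "a < b"
    using J by (auto simp: interval_of_positive_length_def)
  obtain s1 where s1: "s1 \<in> S"
    using S by (auto simp: interval_of_positive_length_def)
  obtain \<mu> c1 where c1: "c1 > 0"
    and scale: "increments_scale J c1 \<mu> v"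
    using v_increments_scale by blast
  obtain \<alpha> \<beta> where v_form: "\<And>y. y \<in> J \<Longrightarrow> v y = \<alpha> * exp_or_id \<mu> y + \<beta>"
    using exp_or_id_if_increments_scale[OF J_interval ab v_cont c1 scale] by blast
  define T where "T = {s + b |s b. s \<in> S \<and> b \<in> v ` interior J}"
  have T_eq: "T = (\<Union>s\<in>S. \<Union>b\<in>v ` interior J. {s + b})"
    by (auto simp: T_def)
  have "\<exists>U m n. open U \<and> t \<in> U \<and> U \<subseteq> T \<and> (\<forall>x\<in>U. exp_or_id (\<mu> / r) (\<phi> x) = m * x + n)"
    if t: "t \<in> T" for t
  proof -
    from t obtain s y where "s \<in> S" "y \<in> interior J" "t = s + v y"
      by (auto simp: T_def)
    with phi_locally_affine[OF c1 scale, of s y] show ?thesis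
      unfolding T_def by blast
  qed
  note loc = this
  have "open T"
    using loc by (subst open_subopen) blast
  have "connected (v ` interior J)"
    using continuous_on_subset[OF v_cont interior_subset] J_interval
    by (intro connected_continuous_image) (simp_all add: convex_connected is_interval_convex convex_interior)
  then have "convex T"
    unfolding T_eq using S_interval
    by (intro convex_sums) (simp_all add: is_interval_convex_1[symmetric] is_interval_connected_1)
  then have "is_interval T"
    by (simp add: is_interval_convex_1)
  then obtain m n where mn: "\<And>t. t \<in> T \<Longrightarrow> exp_or_id (\<mu> / r) (\<phi> t) = m * t + n"
    using locally_affine_imp_affine[of T "\<lambda>t. exp_or_id (\<mu> / r) (\<phi> t)"] \<open>open T\<close> loc by metis
  have int_ab: "{a<..<b} \<subseteq> interior J"
    using J_mem[OF ab(1,2)] by (intro interior_maximal) auto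
  have phi_form: "exp_or_id (\<mu> / r) (\<phi> (s + v y)) = m * (s + v y) + n" if s: "s \<in> S" and y: "y \<in> J" for s y
  proof -
    define D where "D = (\<lambda>y. exp_or_id (\<mu> / r) (\<phi> (s + v y)) - (m * (s + v y) + n))"
    have D_cont: "continuous_on J D"
      unfolding D_def by (intro continuous_intros phi_v_cont s v_cont)
    have D0: "D x = 0" if "x \<in> interior J" for x
      using mn[of "s + v x"] s that by (auto simp: D_def T_def)
    have "closure (interior J) = closure J"
      using J_interval int_ab dense[OF ab(3)] by (intro convex_closure_interior) (auto simp: is_interval_convex)
    then have y_cl: "y \<in> closure (interior J)"
      using y closure_subset by blast
    have "D y = 0"
    proof (cases "y \<in> interior J")
      case False
      with y_cl have "at y within interior J \<noteq> bot"
        by (simp add: closure_def trivial_limit_within)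
      moreover have "(D \<longlongrightarrow> D y) (at y within interior J)"
        using D_cont y interior_subset by (metis continuous_on_def tendsto_within_subset)
      moreover have "(D \<longlongrightarrow> 0) (at y within interior J)"
        by (rule tendsto_eventually) (simp add: eventually_at_filter D0)
      ultimately show ?thesis
        by (rule tendsto_unique)
    qed (rule D0)
    then show ?thesis
      by (simp add: D_def)
  qed
  have "m \<noteq> 0"
  proof
    assume "m = 0"
    then have "\<phi> (s1 + v a) = \<phi> (s1 + v b)"
      using phi_form[OF s1 ab(1)] phi_form[OF s1 ab(2)]
        inj_exp_or_id[of "\<mu> / r" "\<phi> (s1 + v a)" "\<phi> (s1 + v b)"] by simp
    then show False
      using phi_less[OF s1 ab(1) s1 ab(2)] v_less[OF ab(1,2)] ab(3) by simp
  qed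
  then show thesis
    by (rule that[OF _ v_form phi_form])
qed

text \<open>
  If \<open>\<phi> (s + v y)\<close> had this form, then \<open>f (y + k s) = m s + n\<close> would not depend on \<open>y\<close>. But two
  parameters with close values of \<open>k\<close> have overlapping slices, which would give them equal values. In
  Case I this excludes the exponent \<open>\<rho> = 0\<close>, for which \<open>exp (b \<rho> s)\<close> could not depend on \<open>s\<close>.
\<close>

lemma slope_in_y_not_r:
  assumes "m \<noteq> 0" and eq: "\<And>s y. \<lbrakk>s \<in> S; y \<in> J\<rbrakk> \<Longrightarrow> \<phi> (s + v y) = m * s + r * y + n"
  shows False
proof -
  obtain a b where ab: "a \<in> J" "b \<in> J" "a < b"
    using J by (auto simp: interval_of_positive_length_def)
  obtain p q where pq: "p \<in> S" "q \<in> S" "p < q"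
    using S by (auto simp: interval_of_positive_length_def)
  obtain s s' where s: "p \<le> s" "s < s'" "s' \<le> q" "k s' - k s < b - a"
    using small_increment_on_subinterval[of p q "b - a" k] pq ab by auto
  have mem: "s \<in> S" "s' \<in> S"
    using s S_mem[OF pq(1,2), of s] S_mem[OF pq(1,2), of s'] by auto
  define c where "c = k s' - k s"
  have "a + c \<in> J"
    using J_mem[OF ab(1,2), of "a + c"] k_less[OF mem] s by (simp add: c_def)
  then have "\<phi> (s + v (a + c)) = \<phi> (s' + v a) + r * c"
    using phi_shift[OF mem(2,1) _ ab(1), of c] by (simp add: c_def)
  then have "m * s = m * s'"
    using eq[OF mem(1) \<open>a + c \<in> J\<close>] eq[OF mem(2) ab(1)] by (simp add: algebra_simps)
  then show False
    using assms(1) s by simp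
qed

end

section \<open>Return to the original coordinates\<close>

theorem proposition5:
  fixes I S Du Dw DH DF :: "real set"
    and u w H F :: "real \<Rightarrow> real"
    and \<xi> :: "real \<Rightarrow> real \<Rightarrow> real"
    and r :: real
  assumes "interval_of_positive_length I" and "interval_of_positive_length S"
    and "r \<noteq> 0"
    and "continuous_on Du u" and "strict_mono_on Du u"
    and "continuous_on Dw w" and "strict_mono_on Dw w"
    and "continuous_on DH H" and "strict_mono_on DH H"
    and "continuous_on DF F"
    and "Du \<subseteq> {0<..}" and "Dw \<subseteq> {0<..}" and "DH \<subseteq> {0<..}" and "F ` DF \<subseteq> {0<..}"
    and "I \<subseteq> Dw"
    and "S \<subseteq> H ` DH"
    and "\<And>x s. x \<in> I \<Longrightarrow> s \<in> S \<Longrightarrow> x * inv_into DH H s \<in> DF"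
    and "\<And>x s. x \<in> I \<Longrightarrow> s \<in> S \<Longrightarrow> s + w x \<in> u ` Du"
    and "\<And>x s. x \<in> I \<Longrightarrow> s \<in> S \<Longrightarrow> \<xi> s x = x powr r * F (x * inv_into DH H s)"
    and "\<And>x s. x \<in> I \<Longrightarrow> s \<in> S \<Longrightarrow> \<xi> s x = inv_into Du u (s + w x)"
  shows "case_I I S r \<xi> \<or> case_II I S r \<xi>"
proof -
  note I = assms(1) and S = assms(2) and r = assms(3) and u_mono = assms(5)
    and w_cont = assms(6) and w_mono = assms(7) and H_mono = assms(9) and F_cont = assms(10)
    and u_pos = assms(11) and w_pos = assms(12) and H_pos = assms(13) and F_pos = assms(14)
    and I_Dw = assms(15) and S_H = assms(16) and in_DF = assms(17) and in_u = assms(18)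
    and xi_F = assms(19) and xi_u = assms(20)
  define h where "h = inv_into DH H"
  define U where "U = inv_into Du u"
  define J where "J = ln ` I"
  have I_pos: "x > 0" if "x \<in> I" for x
    using that I_Dw w_pos by auto
  have exp_J: "exp y \<in> I" if "y \<in> J" for y
    using that I_pos by (auto simp: J_def)
  have h_pos: "h s > 0" and H_h: "h s \<in> DH" "H (h s) = s" if "s \<in> S" for s
    using that S_H H_pos inv_into_into[of s H DH] f_inv_into_f[of s H DH] by (auto simp: h_def)
  have h_less: "h s < h s'" if "s \<in> S" "s' \<in> S" "s < s'" for s s'
    using strict_mono_on_less[OF H_mono, of "h s" "h s'"] H_h that by simp
  have U_less: "U t < U t'" if "t \<in> u ` Du" "t' \<in> u ` Du" "t < t'" for t t'
    using strict_mono_on_less[OF u_mono, of "U t" "U t'"] that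
    by (auto simp: U_def inv_into_into f_inv_into_f)
  have U_pos: "U t > 0" if "t \<in> u ` Du" for t
    using inv_into_into[OF that] u_pos by (auto simp: U_def)
  have exp_shift: "exp (y + ln (h s)) = exp y * h s" if "s \<in> S" for y s
    using h_pos[OF that] by (simp add: exp_add)
  interpret log_family J S "\<lambda>y. w (exp y)" "\<lambda>s. ln (h s)" "\<lambda>t. ln (U t)" "\<lambda>z. ln (F (exp z))" r
  proof
    obtain p q where pq: "p \<in> I" "q \<in> I" "p < q"
      using I by (auto simp: interval_of_positive_length_def)
    have "connected J"
      unfolding J_def using I I_pos
      by (intro connected_continuous_image continuous_intros)
        (auto simp: interval_of_positive_length_def is_interval_connected_1)
    moreover have "ln p \<in> J" "ln q \<in> J" "ln p < ln q"
      using pq I_pos by (auto simp: J_def)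
    ultimately show "interval_of_positive_length J"
      unfolding interval_of_positive_length_def is_interval_connected_1 by blast
    show "continuous_on J (\<lambda>y. w (exp y))"
      by (rule continuous_on_compose2[OF w_cont]) (use exp_J I_Dw in \<open>auto intro!: continuous_intros\<close>)
    show "strict_mono_on J (\<lambda>y. w (exp y))"
      using exp_J I_Dw by (intro strict_mono_onI strict_mono_onD[OF w_mono]) auto
    show "strict_mono_on S (\<lambda>s. ln (h s))"
      using h_less h_pos by (intro strict_mono_onI) simp
    show "strict_mono_on {s + w (exp y) |s y. s \<in> S \<and> y \<in> J} (\<lambda>t. ln (U t))"
    proof (rule strict_mono_onI)
      fix t t' assume t: "t \<in> {s + w (exp y) |s y. s \<in> S \<and> y \<in> J}"
        "t' \<in> {s + w (exp y) |s y. s \<in> S \<and> y \<in> J}" "t < t'"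
      then have "t \<in> u ` Du" "t' \<in> u ` Du"
        using in_u exp_J by blast+
      then show "ln (U t) < ln (U t')"
        using U_less U_pos t(3) by simp
    qed
    fix s assume s: "s \<in> S"
    have DF: "exp y * h s \<in> DF" if "y \<in> J" for y
      using in_DF[OF exp_J[OF that] s] by (simp add: h_def)
    then have F: "F (exp y * h s) > 0" if "y \<in> J" for y
      using F_pos that by blast
    have "continuous_on J (\<lambda>y. F (exp y * h s))"
      by (rule continuous_on_compose2[OF F_cont]) (use DF in \<open>auto intro!: continuous_intros\<close>)
    then show "continuous_on J (\<lambda>y. ln (F (exp (y + ln (h s)))))"
      using F unfolding exp_shift[OF s] by (intro continuous_on_ln) force+
    fix y assume y: "y \<in> J"
    have "U (s + w (exp y)) = exp y powr r * F (exp y * h s)"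
      using xi_F[OF exp_J[OF y] s] xi_u[OF exp_J[OF y] s] by (simp add: h_def U_def)
    then show "ln (U (s + w (exp y))) = r * y + ln (F (exp (y + ln (h s))))"
      using F[OF y] by (simp add: exp_shift[OF s] ln_mult_pos ln_powr)
  qed (use S r in auto)
  obtain \<mu> \<alpha> \<beta> m n where m: "m \<noteq> 0"
    and v_form: "\<And>y. y \<in> J \<Longrightarrow> w (exp y) = \<alpha> * exp_or_id \<mu> y + \<beta>"
    and phi_form: "\<And>s y. \<lbrakk>s \<in> S; y \<in> J\<rbrakk> \<Longrightarrow> exp_or_id (\<mu> / r) (ln (U (s + w (exp y)))) = m * (s + w (exp y)) + n"
    using representation by metis
  have xi_pos: "\<xi> s x > 0" and xi_form: "exp_or_id (\<mu> / r) (ln (\<xi> s x)) = m * (s + (\<alpha> * exp_or_id \<mu> (ln x) + \<beta>)) + n"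
    if x: "x \<in> I" and s: "s \<in> S" for x s
  proof -
    show "\<xi> s x > 0"
      using U_pos[OF in_u[OF x s]] xi_u[OF x s] by (simp add: U_def)
    have "ln x \<in> J"
      using x by (simp add: J_def)
    then show "exp_or_id (\<mu> / r) (ln (\<xi> s x)) = m * (s + (\<alpha> * exp_or_id \<mu> (ln x) + \<beta>)) + n"
      using phi_form[OF s, of "ln x"] v_form[of "ln x"] xi_u[OF x s] I_pos[OF x] by (simp add: U_def)
  qed
  show ?thesis
  proof (cases "\<mu> = 0")
    case True
    define \<rho> where "\<rho> = m * \<alpha> - r"
    have "\<rho> \<noteq> 0"
    proof
      assume "\<rho> = 0"
      then have "ln (U (s + w (exp y))) = m * s + r * y + (m * \<beta> + n)" if "s \<in> S" "y \<in> J" for s y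
        using phi_form[OF that] v_form[OF that(2)] True by (simp add: exp_or_id_def \<rho>_def algebra_simps)
      then show False
        using slope_in_y_not_r[OF m] by blast
    qed
    have "\<xi> s x = exp (m * \<beta> + n) * exp (m / \<rho> * \<rho> * s) * x powr (r + \<rho>)" if "x \<in> I" "s \<in> S" for x s
    proof -
      have "\<xi> s x = exp (m * (s + (\<alpha> * ln x + \<beta>)) + n)"
        using xi_form[OF that] exp_ln[OF xi_pos[OF that]] True by (simp add: exp_or_id_def)
      also have "\<dots> = exp (m * \<beta> + n) * exp (m * s) * exp (m * \<alpha> * ln x)"
        by (simp add: exp_add[symmetric] algebra_simps)
      finally show ?thesis
        using \<open>\<rho> \<noteq> 0\<close> I_pos[OF that(1)] by (simp add: powr_def \<rho>_def)
    qed
    then show ?thesis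
      unfolding case_I_def by blast
  next
    case False
    \<comment> \<open>The sign of \<open>m\<close> is the sign of the base, because \<open>m\<close> times the base is an exponential.\<close>
    define \<rho> \<epsilon> sg where "\<rho> = r / \<mu>" and "\<epsilon> = - (\<beta> + n / m)" and "sg = sgn m"
    have "\<rho> \<noteq> 0" and "r / \<rho> = \<mu>" and "sg \<in> {1, - 1}"
      using False r m by (auto simp: \<rho>_def sg_def sgn_if)
    have "sg * (\<alpha> * x powr (r / \<rho>) + s - \<epsilon>) > 0 \<and>
        \<xi> s x = \<bar>m\<bar> powr \<rho> * (sg * (\<alpha> * x powr (r / \<rho>) + s - \<epsilon>)) powr \<rho>"
      if "x \<in> I" "s \<in> S" for x s
    proof -
      define B where "B = sg * (\<alpha> * x powr \<mu> + s - \<epsilon>)"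
      have "m * (s + (\<alpha> * x powr \<mu> + \<beta>)) + n = m * (\<alpha> * x powr \<mu> + s - \<epsilon>)"
        using m by (simp add: \<epsilon>_def field_simps)
      also have "\<dots> = \<bar>m\<bar> * B"
        by (simp add: B_def sg_def abs_mult_sgn mult.assoc[symmetric])
      finally have B: "exp (\<mu> / r * ln (\<xi> s x)) = \<bar>m\<bar> * B"
        using xi_form[OF that] I_pos[OF that(1)] False r by (simp add: exp_or_id_def powr_def)
      then have "\<bar>m\<bar> * B > 0"
        by (metis exp_gt_zero)
      then have "B > 0"
        using m by (simp add: zero_less_mult_iff)
      have "\<xi> s x = exp (\<mu> / r * ln (\<xi> s x)) powr \<rho>"
        using xi_pos[OF that] False r by (simp add: powr_def \<rho>_def)
      also have "\<dots> = \<bar>m\<bar> powr \<rho> * B powr \<rho>"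
        unfolding B using \<open>B > 0\<close> by (simp add: powr_mult)
      finally show ?thesis
        using \<open>B > 0\<close> by (simp add: B_def \<open>r / \<rho> = \<mu>\<close>)
    qed
    with \<open>\<rho> \<noteq> 0\<close> \<open>sg \<in> {1, - 1}\<close> show ?thesis
      unfolding case_II_def by blast
  qed
qed

end
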